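(* Assume that the optimal transport problem $(\mu,\nu,b)$ is discretely nested and that $\mu$ does not charge any of the sets $X^N_{=}(y_i,k)$ (that is, $\mu(X^N_{=}(y_i,k))=0$ for all $0\le i\le N-1$ and $k\in\mathbb R$). Set $$X_0=X^N_{<}(y_0,k^N(y_0)),\qquad X_N=X\setminus X^N_{\le}(y_{N-1},k^N(y_{N-1})),$$ $$X_i=X^N_{<}(y_i,k^N(y_i))\setminus X^N_{\le}(y_{i-1},k^N(y_{i-1}))\quad\text{for }0<i<N.$$ Then the potentials $(u,v)$ defined by $v(y_0)=0$, $$v(y_i)=\sum_{k=0}^{i-1}\big(b(a_k,y_{k+1})-b(a_k,y_k)\big),\qquad u(x)=b(x,y_i)-v(y_i)\ \text{ for all }x\in X_i,$$ solve the dual problem $$\inf\Big\{\int_X u\,d\mu+\int_Y v\,d\nu:\ (u,v)\in L^1(\mu)\times L^1(\nu),\ u(x)+v(y)\ge b(x,y)\text{ on }X\times Y\Big\},$$ for any $a_k\in X^N_{=}(y_k,k^N(y_k))$. Furthermore, the mapping $T$ sending all $x\in X_i$ to $y_i$, for each $i=0,1,\dots,N$, is an optimal map.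
   Context: Setting: $X\subset\mathbb R^m$ is a bounded domain, $Y=Y_N=\{y_0<y_1<\dots<y_N\}\subset\mathbb R$ is finite, $b\in C(X\times Y)$ is a surplus function, differentiable in $x$, with $D_xb(x,y_i)-D_xb(x,y_{i-1})\ne0$ for all $x\in X$ and $0<i\le N$. $\mu$ is a probability measure on $X$ with $\mu(A)>0$ for every nonempty open $A\subseteq X$, and $\nu=\sum_{i=0}^N\nu_i\delta_{y_i}$ is a probability measure on $Y_N$. Optimal transport problem $(\mu,\nu,b)$: maximize $\int_{X\times Y}b\,d\gamma$ over probability measures $\gamma$ on $X\times Y$ with marginals $\mu$ and $\nu$. A map $T:X\to Y$ is an optimal map if some maximizer $\gamma$ vanishes outside the graph of $T$ (then $T_\#\mu=\nu$). Level sets: for $0\le i\le N-1$, $k\in\mathbb R$, $X^N_{=}(y_i,k)=\{x\in X:b(x,y_{i+1})-b(x,y_i)=k\}$, $X^N_{\le}(y_i,k)=\{x\in X:b(x,y_{i+1})-b(x,y_i)\le k\}$, $X^N_{<}(y_i,k)=X^N_{\le}(y_i,k)\setminus X^N_{=}(y_i,k)$. The number $k^N(y_r)$ satisfies $\mu(X^N_{\le}(y_r,k^N(y_r)))=\nu(\{y_p:0\le p\le r\})$. Discrete nestedness: $(\mu,\nu,b)$ is discretely nested if for all $i<j$ in $\{0,\dots,N-1\}$, $\nu(\{y_k:i<k\le j\})>0$ implies $X^N_{\le}(y_i,k^N(y_i))\subset X^N_{<}(y_j,k^N(y_j))$.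
   Formalization: b is assumed integrable against every probability measure with marginals μ and ν (otherwise u need not be in L^1(μ)); if some interior ν_i (0<i<N) is 0, the sets X_i are assumed pairwise disjoint (otherwise u and T can be ill-defined). *)

theory Defs
  imports "HOL-Probability.Probability"
begin

text \<open>The points \<open>y_0 < ... < y_N\<close> are given by a function on \<^typ>\<open>nat\<close>, of which only the
  values on \<open>{..N}\<close> matter; the level set attached to \<open>y_i\<close> is indexed by \<open>i\<close>.\<close>

definition level_eq ::
  "'a set \<Rightarrow> ('a \<Rightarrow> real \<Rightarrow> real) \<Rightarrow> (nat \<Rightarrow> real) \<Rightarrow> nat \<Rightarrow> real \<Rightarrow> 'a set" where
  "level_eq X b y i k = {x \<in> X. b x (y (Suc i)) - b x (y i) = k}"

definition level_le ::
  "'a set \<Rightarrow> ('a \<Rightarrow> real \<Rightarrow> real) \<Rightarrow> (nat \<Rightarrow> real) \<Rightarrow> nat \<Rightarrow> real \<Rightarrow> 'a set" where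
  "level_le X b y i k = {x \<in> X. b x (y (Suc i)) - b x (y i) \<le> k}"

definition level_less ::
  "'a set \<Rightarrow> ('a \<Rightarrow> real \<Rightarrow> real) \<Rightarrow> (nat \<Rightarrow> real) \<Rightarrow> nat \<Rightarrow> real \<Rightarrow> 'a set" where
  "level_less X b y i k = level_le X b y i k - level_eq X b y i k"

text \<open>The splitting levels \<open>k_r\<close> are not unique when the prescribed mass is 0 or 1, so they are
  a parameter characterised by a predicate rather than a function of the data.\<close>

definition splitting_levels ::
  "'a measure \<Rightarrow> real measure \<Rightarrow> ('a \<Rightarrow> real \<Rightarrow> real) \<Rightarrow> (nat \<Rightarrow> real) \<Rightarrow> nat \<Rightarrow> (nat \<Rightarrow> real) \<Rightarrow> bool"
where
  "splitting_levels \<mu> \<nu> b y N k \<longleftrightarrow>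
     (\<forall>r<N. measure \<mu> (level_le (space \<mu>) b y r (k r)) = measure \<nu> {y p | p. p \<le> r})"

definition discretely_nested ::
  "'a measure \<Rightarrow> real measure \<Rightarrow> ('a \<Rightarrow> real \<Rightarrow> real) \<Rightarrow> (nat \<Rightarrow> real) \<Rightarrow> nat \<Rightarrow> (nat \<Rightarrow> real) \<Rightarrow> bool"
where
  "discretely_nested \<mu> \<nu> b y N k \<longleftrightarrow>
     (\<forall>i j. i < j \<and> j < N \<and> measure \<nu> {y l | l. i < l \<and> l \<le> j} > 0 \<longrightarrow>
        level_le (space \<mu>) b y i (k i) \<subseteq> level_less (space \<mu>) b y j (k j))"

text \<open>The sets \<open>X_0, ..., X_N\<close>; meaningful for \<open>N \<ge> 1\<close> and \<open>i \<le> N\<close>.\<close>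

definition cell ::
  "'a set \<Rightarrow> ('a \<Rightarrow> real \<Rightarrow> real) \<Rightarrow> (nat \<Rightarrow> real) \<Rightarrow> nat \<Rightarrow> (nat \<Rightarrow> real) \<Rightarrow> nat \<Rightarrow> 'a set" where
  "cell X b y N k i =
     (if i = 0 then level_less X b y 0 (k 0)
      else if i = N then X - level_le X b y (N - 1) (k (N - 1))
      else level_less X b y i (k i) - level_le X b y (i - 1) (k (i - 1)))"

definition couplings :: "'a measure \<Rightarrow> 'b measure \<Rightarrow> ('a \<times> 'b) measure set" where
  "couplings \<mu> \<nu> = {\<gamma>. prob_space \<gamma> \<and> sets \<gamma> = sets (\<mu> \<Otimes>\<^sub>M \<nu>) \<and>
                        distr \<gamma> \<mu> fst = \<mu> \<and> distr \<gamma> \<nu> snd = \<nu>}"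

text \<open>The Bochner integral of a non-integrable function is 0 by convention, so this notion is
  only to be used when \<open>b\<close> is integrable against every coupling.\<close>

definition optimal_plan ::
  "'a measure \<Rightarrow> 'b measure \<Rightarrow> ('a \<Rightarrow> 'b \<Rightarrow> real) \<Rightarrow> ('a \<times> 'b) measure \<Rightarrow> bool" where
  "optimal_plan \<mu> \<nu> b \<gamma> \<longleftrightarrow> \<gamma> \<in> couplings \<mu> \<nu> \<and>
     (\<forall>\<gamma>'\<in>couplings \<mu> \<nu>. (\<integral>(x, t). b x t \<partial>\<gamma>') \<le> (\<integral>(x, t). b x t \<partial>\<gamma>))"

text \<open>That \<open>\<gamma>\<close> vanishes outside the graph of \<open>T\<close> is stated almost everywhere: the complement of
  the graph lies in a \<open>\<gamma>\<close>-null set. The graph itself need not be measurable when \<open>T\<close> is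
  unspecified on a \<open>\<mu>\<close>-null set.\<close>

definition optimal_map ::
  "'a measure \<Rightarrow> 'b measure \<Rightarrow> ('a \<Rightarrow> 'b \<Rightarrow> real) \<Rightarrow> ('a \<Rightarrow> 'b) \<Rightarrow> bool" where
  "optimal_map \<mu> \<nu> b T \<longleftrightarrow> T \<in> space \<mu> \<rightarrow> space \<nu> \<and>
     (\<exists>\<gamma>. optimal_plan \<mu> \<nu> b \<gamma> \<and> (AE p in \<gamma>. snd p = T (fst p)))"

definition dual_feasible ::
  "'a measure \<Rightarrow> 'b measure \<Rightarrow> ('a \<Rightarrow> 'b \<Rightarrow> real) \<Rightarrow> ('a \<Rightarrow> real) \<Rightarrow> ('b \<Rightarrow> real) \<Rightarrow> bool" where
  "dual_feasible \<mu> \<nu> b u v \<longleftrightarrow> integrable \<mu> u \<and> integrable \<nu> v \<and>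
     (\<forall>x\<in>space \<mu>. \<forall>t\<in>space \<nu>. u x + v t \<ge> b x t)"

definition solves_dual ::
  "'a measure \<Rightarrow> 'b measure \<Rightarrow> ('a \<Rightarrow> 'b \<Rightarrow> real) \<Rightarrow> ('a \<Rightarrow> real) \<Rightarrow> ('b \<Rightarrow> real) \<Rightarrow> bool" where
  "solves_dual \<mu> \<nu> b u v \<longleftrightarrow> dual_feasible \<mu> \<nu> b u v \<and>
     (\<forall>u' v'. dual_feasible \<mu> \<nu> b u' v' \<longrightarrow>
        (\<integral>x. u x \<partial>\<mu>) + (\<integral>t. v t \<partial>\<nu>) \<le> (\<integral>x. u' x \<partial>\<mu>) + (\<integral>t. v' t \<partial>\<nu>))"

end

theory Submission
  imports Defs
begin

text \<open>
  Write \<open>d\<^sub>j(x) = b(x, y\<^sub>j\<^sub>+\<^sub>1) - b(x, y\<^sub>j)\<close>. Since \<open>d\<^sub>j(a\<^sub>j) = k\<^sub>j\<close>, the potential is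
  \<open>v(y\<^sub>i) = k\<^sub>0 + ... + k\<^sub>i\<^sub>-\<^sub>1\<close>: the levels act as price increments. A consumer \<open>x\<close> who faces these
  prices gains \<open>d\<^sub>j(x) - k\<^sub>j\<close> by moving from \<open>y\<^sub>j\<close> to \<open>y\<^sub>j\<^sub>+\<^sub>1\<close>. If these gains are nonnegative below
  index \<open>i\<close> and nonpositive from \<open>i\<close> on, then \<open>y\<^sub>i\<close> is a best reply of \<open>x\<close>
  (\<open>sign_pattern_best_reply\<close>). So everything rests on this sign pattern for the points of \<open>X\<^sub>i\<close>.

  The definition of \<open>X\<^sub>i\<close> prescribes only two of the signs: positive at \<open>i - 1\<close>, negative at \<open>i\<close>.
  But if all gains at \<open>x\<close> are nonzero, each change from plus to minus in the sequence of signs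
  (completed by a plus on the left and a minus on the right) puts \<open>x\<close> in a cell. There is at least one
  change, and disjointness of the cells allows only one, so the sequence is a block of pluses followed
  by a block of minuses (\<open>generic_cell_signs\<close>). Disjointness comes from nestedness when every interior
  point of \<open>Y\<close> carries mass (\<open>nested_imp_cells_disjoint\<close>), and is a hypothesis otherwise. Points
  with a vanishing gain form a null set without interior, and near a point of a cell where a gain has
  the wrong strict sign the cell would contain generic points with the same wrong sign; hence the weak
  sign pattern holds throughout each cell (\<open>cell_signs\<close>).

  The sign pattern also identifies \<open>X\<^sub>0 \<union> ... \<union> X\<^sub>r\<close> with \<open>{d\<^sub>r \<le> k\<^sub>r}\<close> up to a null set. The splitting
  levels therefore give the map \<open>T\<close> the cumulative masses of \<open>\<nu>\<close>, that is, \<open>T\<close> pushes \<open>\<mu>\<close> forward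
  to \<open>\<nu>\<close> (\<open>distr_eq_of_cumulative\<close>). The potentials are feasible, and \<open>u(x) + v(T(x)) = b(x, T(x))\<close>
  holds almost everywhere; complementary slackness makes the potentials and the plan carried by the
  graph of \<open>T\<close> optimal at the same time (\<open>tight_map_optimal\<close>).
\<close>

section \<open>Cells and sign patterns\<close>

text \<open>
  The marginal surplus of moving from \<open>y j\<close> to \<open>y (j + 1)\<close>, whose level sets bound the cells.
\<close>
abbreviation (input) incr :: "('a \<Rightarrow> real \<Rightarrow> real) \<Rightarrow> (nat \<Rightarrow> real) \<Rightarrow> nat \<Rightarrow> 'a \<Rightarrow> real" where
  "incr b y j x \<equiv> b x (y (Suc j)) - b x (y j)"

lemma in_cell_iff:
  assumes "1 \<le> N" "i \<le> N"
  shows "x \<in> cell X b y N k i \<longleftrightarrow>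
    x \<in> X \<and> (i = 0 \<or> k (i - 1) < incr b y (i - 1) x) \<and> (i = N \<or> incr b y i x < k i)"
  using assms by (auto simp: cell_def level_less_def level_le_def level_eq_def)

text \<open>
  A total and measurable candidate for the index of the cell of \<open>x\<close>. The index \<open>N\<close> satisfies the
  condition vacuously, which accounts for the points whose increments never fall below the levels.
\<close>
definition first_drop ::
  "('a \<Rightarrow> real \<Rightarrow> real) \<Rightarrow> (nat \<Rightarrow> real) \<Rightarrow> nat \<Rightarrow> (nat \<Rightarrow> real) \<Rightarrow> 'a \<Rightarrow> nat" where
  "first_drop b y N k x = (LEAST i. i < N \<longrightarrow> incr b y i x < k i)"

lemma first_drop_le: "first_drop b y N k x \<le> N"
  unfolding first_drop_def by (rule Least_le) simp

lemma first_drop_cases: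
  "first_drop b y N k x = N \<or> incr b y (first_drop b y N k x) x < k (first_drop b y N k x)"
  using LeastI[of "\<lambda>i. i < N \<longrightarrow> incr b y i x < k i" N] first_drop_le[of b y N k x]
  unfolding first_drop_def by auto

lemma below_first_drop:
  "j < first_drop b y N k x \<Longrightarrow> k j \<le> incr b y j x"
  unfolding first_drop_def by (drule not_less_Least) auto

lemma measurable_first_drop:
  assumes "\<And>j. j < N \<Longrightarrow> incr b y j \<in> borel_measurable M"
  shows "first_drop b y N k \<in> measurable M (count_space UNIV)"
proof -
  have "Measurable.pred M (\<lambda>x. i < N \<longrightarrow> incr b y i x < k i)" for i
  proof (cases "i < N")
    case True
    then have "incr b y i \<in> borel_measurable M" by (rule assms)
    then show ?thesis by measurable
  qed simp
  then have "(\<lambda>x. LEAST i. i < N \<longrightarrow> incr b y i x < k i) \<in> measurable M (count_space UNIV)"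
    by (rule measurable_Least)
  then show ?thesis unfolding first_drop_def[abs_def] .
qed

text \<open>
  The first change from plus to minus witnesses that the cells cover all generic points.
\<close>
lemma generic_in_cell_first_drop:
  assumes N: "1 \<le> N" and x: "x \<in> X" and gen: "\<And>j. j < N \<Longrightarrow> incr b y j x \<noteq> k j"
  shows "x \<in> cell X b y N k (first_drop b y N k x)"
proof -
  let ?i = "first_drop b y N k x"
  have "?i = 0 \<or> k (?i - 1) < incr b y (?i - 1) x"
  proof (cases "?i = 0")
    case False
    then have "?i - 1 < ?i" "?i - 1 < N" using first_drop_le[of b y N k x] by linarith+
    then show ?thesis using below_first_drop[of "?i - 1" b y N k x] gen[of "?i - 1"] by linarith
  qed simp
  then show ?thesis
    using x first_drop_cases[of b y N k x] by (simp add: in_cell_iff[OF N first_drop_le])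
qed

text \<open>
  A minus before \<open>i\<close>, or a plus at or after \<open>i\<close>, forces a second change from plus to minus in the
  sequence of signs, and thus puts \<open>x\<close> in a second cell.
\<close>
lemma generic_cell_signs:
  assumes N: "1 \<le> N"
    and disj: "disjoint_family_on (cell X b y N k) {..N}"
    and i: "i \<le> N" "x \<in> cell X b y N k i"
    and gen: "\<And>j. j < N \<Longrightarrow> incr b y j x \<noteq> k j"
  shows "j < i \<Longrightarrow> k j < incr b y j x"
    and "i \<le> j \<Longrightarrow> j < N \<Longrightarrow> incr b y j x < k j"
proof -
  have unique: "l = i" if "l \<le> N" "x \<in> cell X b y N k l" for l
    using disj i that unfolding disjoint_family_on_def by (metis IntI atMost_iff empty_iff)
  have x: "x \<in> X" using i(2) by (simp add: in_cell_iff[OF N i(1)])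
  have "first_drop b y N k x = i"
    using unique[OF first_drop_le generic_in_cell_first_drop[of N x X b y k, OF N x gen]] .
  then show "k j < incr b y j x" if "j < i"
    using below_first_drop[of j b y N k x] gen[of j] that i(1) by linarith
  show "incr b y j x < k j" if j: "i \<le> j" "j < N"
  proof (rule ccontr)
    assume "\<not> incr b y j x < k j"
    then have up: "k j < incr b y j x" using gen[OF j(2)] by simp
    \<comment> \<open>The first index after \<open>j\<close> without a plus, or \<open>N\<close>: the sequence of signs drops there a second time.\<close>
    define l where "l = (LEAST l. j < l \<and> (l = N \<or> incr b y l x < k l))"
    have l: "j < l \<and> (l = N \<or> incr b y l x < k l)"
      unfolding l_def by (rule LeastI[of _ N]) (use j in simp)
    have lN: "l \<le> N" unfolding l_def by (rule Least_le) (use j in simp)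
    have "k (l - 1) < incr b y (l - 1) x"
    proof (cases "l - 1 = j")
      case False
      then have "\<not> incr b y (l - 1) x < k (l - 1)"
        using not_less_Least[of "l - 1" "\<lambda>l. j < l \<and> (l = N \<or> incr b y l x < k l)"] l
        unfolding l_def[symmetric] by auto
      moreover have "l - 1 < N" using l lN by linarith
      ultimately show ?thesis using gen[of "l - 1"] by linarith
    qed (use up in simp)
    then have "x \<in> cell X b y N k l" using l x by (simp add: in_cell_iff[OF N lN])
    then show False using unique[OF lN] l j by simp
  qed
qed

text \<open>
  A wrong strict sign persists on a neighbourhood within the cell, which contains a generic point; so
  the strict pattern at generic points extends to all points of the cell as a weak one.
\<close>
lemma cell_signs:
  fixes X :: "'a::topological_space set"
  assumes N: "1 \<le> N" and X: "open X"
    and cont: "\<And>j. j \<le> N \<Longrightarrow> continuous_on X (\<lambda>x. b x (y j))"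
    and dense: "\<And>A. open A \<Longrightarrow> A \<noteq> {} \<Longrightarrow> A \<subseteq> X \<Longrightarrow> \<exists>z\<in>A. \<forall>j<N. incr b y j z \<noteq> k j"
    and disj: "disjoint_family_on (cell X b y N k) {..N}"
    and i: "i \<le> N" "x \<in> cell X b y N k i"
  shows "j < i \<Longrightarrow> k j \<le> incr b y j x"
    and "i \<le> j \<Longrightarrow> j < N \<Longrightarrow> incr b y j x \<le> k j"
proof -
  have below: "open {z \<in> X. incr b y j z < c}" and above: "open {z \<in> X. c < incr b y j z}"
    if "j < N" for j c
  proof -
    have "continuous_on X (incr b y j)" using that by (intro continuous_intros cont) auto
    then have "open (X \<inter> incr b y j -` {..<c})" "open (X \<inter> incr b y j -` {c<..})"
      by (auto intro: continuous_open_preimage simp: X)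
    then show "open {z \<in> X. incr b y j z < c}" "open {z \<in> X. c < incr b y j z}"
      by (simp_all add: vimage_def Int_def)
  qed
  have cell: "cell X b y N k i = (if i = 0 then X else {z \<in> X. k (i - 1) < incr b y (i - 1) z}) \<inter>
      (if i = N then X else {z \<in> X. incr b y i z < k i})"
    by (rule set_eqI) (simp add: in_cell_iff[OF N i(1)], blast)
  have openc: "open (cell X b y N k i)"
    unfolding cell using below[of i "k i"] above[of "i - 1" "k (i - 1)"] X i(1) by auto
  have sub: "cell X b y N k i \<subseteq> X" unfolding cell by auto
  show "k j \<le> incr b y j x" if j: "j < i"
  proof (rule ccontr)
    assume "\<not> ?thesis"
    then have "x \<in> cell X b y N k i \<inter> {z \<in> X. incr b y j z < k j}" using i sub by auto
    then obtain z where z: "z \<in> cell X b y N k i" "incr b y j z < k j"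
      "\<forall>j<N. incr b y j z \<noteq> k j"
      using dense[of "cell X b y N k i \<inter> {z \<in> X. incr b y j z < k j}"] openc below[of j "k j"] sub j i
      by auto
    then show False using generic_cell_signs(1)[OF N disj i(1) z(1) _ j] by auto
  qed
  show "incr b y j x \<le> k j" if j: "i \<le> j" "j < N"
  proof (rule ccontr)
    assume "\<not> ?thesis"
    then have "x \<in> cell X b y N k i \<inter> {z \<in> X. k j < incr b y j z}" using i sub by auto
    then obtain z where z: "z \<in> cell X b y N k i" "k j < incr b y j z"
      "\<forall>j<N. incr b y j z \<noteq> k j"
      using dense[of "cell X b y N k i \<inter> {z \<in> X. k j < incr b y j z}"] openc above[of j "k j"] sub j i
      by auto
    then show False using generic_cell_signs(2)[OF N disj i(1) z(1) _ j] by auto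
  qed
qed

text \<open>
  The net values of two replies differ by a telescoping sum of net gains, all of the same sign.
\<close>
lemma sign_pattern_best_reply:
  assumes i: "i \<le> N"
    and ge: "\<And>j. j < i \<Longrightarrow> k j \<le> incr b y j x"
    and le: "\<And>j. i \<le> j \<Longrightarrow> j < N \<Longrightarrow> incr b y j x \<le> k j"
    and l: "l \<le> N"
  shows "b x (y l) - (\<Sum>j<l. k j) \<le> b x (y i) - (\<Sum>j<i. k j)"
proof -
  have tele: "b x (y n) - (\<Sum>j<n. k j) = b x (y m) - (\<Sum>j<m. k j) + (\<Sum>j=m..<n. incr b y j x - k j)"
    if "m \<le> n" for m n
    using that by (induction n rule: dec_induct) auto
  show ?thesis
  proof (cases "i \<le> l")
    case True
    have "(\<Sum>j=i..<l. incr b y j x - k j) \<le> 0"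
      by (rule sum_nonpos) (use le l in force)
    then show ?thesis using tele[OF True] by linarith
  next
    case False
    have "0 \<le> (\<Sum>j=l..<i. incr b y j x - k j)"
      by (rule sum_nonneg) (use ge in force)
    then show ?thesis using tele[of l i] False by linarith
  qed
qed

text \<open>
  A point common to the cells \<open>i < j\<close> lies below level \<open>i\<close> and above level \<open>j - 1\<close>. For \<open>i = j - 1\<close> this
  is absurd; for \<open>i < j - 1\<close> it contradicts nestedness, the mass of \<open>y (j - 1)\<close> being positive.
\<close>
lemma nested_imp_cells_disjoint:
  assumes N: "1 \<le> N" and \<nu>: "finite_measure \<nu>" "sets \<nu> = Pow (y ` {..N})"
    and nested: "discretely_nested \<mu> \<nu> b y N k"
    and charged: "\<And>i. 0 < i \<Longrightarrow> i < N \<Longrightarrow> measure \<nu> {y i} \<noteq> 0"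
  shows "disjoint_family_on (cell (space \<mu>) b y N k) {..N}"
proof -
  have "cell (space \<mu>) b y N k i \<inter> cell (space \<mu>) b y N k j = {}"
    if ij: "i < j" "j \<le> N" for i j
  proof (rule ccontr)
    assume "\<not> ?thesis"
    then obtain x where "x \<in> cell (space \<mu>) b y N k i" "x \<in> cell (space \<mu>) b y N k j" by auto
    then have x: "x \<in> space \<mu>" "incr b y i x < k i" "k (j - 1) < incr b y (j - 1) x"
      using ij by (auto simp: in_cell_iff[OF N])
    then have ne: "i < j - 1" using ij by (cases "i = j - 1") auto
    have "0 < measure \<nu> {y (j - 1)}"
      using charged[of "j - 1"] ne ij by (simp add: zero_less_measure_iff)
    also have "\<dots> \<le> measure \<nu> {y l | l. i < l \<and> l \<le> j - 1}"
      using ij ne by (intro finite_measure.finite_measure_mono \<nu>) (auto simp: \<nu>)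
    finally have "level_le (space \<mu>) b y i (k i) \<subseteq> level_less (space \<mu>) b y (j - 1) (k (j - 1))"
      using nested ne ij unfolding discretely_nested_def by auto
    then show False using x by (auto simp: level_le_def level_less_def)
  qed
  then show ?thesis
    unfolding disjoint_family_on_def by (metis Int_commute atMost_iff linorder_neqE_nat)
qed

section \<open>Pushing a measure forward to a finite set\<close>

text \<open>
  On finitely many atoms, cumulative masses determine a measure: each atom is a difference of two of
  them.
\<close>
lemma distr_eq_of_cumulative:
  fixes y :: "nat \<Rightarrow> real"
  assumes \<mu>: "finite_measure \<mu>" and \<nu>: "finite_measure \<nu>" "sets \<nu> = Pow (y ` {..N})"
    and inj: "inj_on y {..N}"
    and F: "F \<in> measurable \<mu> (count_space UNIV)" "\<And>x. F x \<le> N"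
    and cum: "\<And>r. r \<le> N \<Longrightarrow> measure \<mu> {x \<in> space \<mu>. F x \<le> r} = measure \<nu> {y p | p. p \<le> r}"
  shows "distr \<mu> \<nu> (\<lambda>x. y (F x)) = \<nu>"
proof -
  interpret \<mu>: finite_measure \<mu> by fact
  interpret \<nu>: finite_measure \<nu> by fact
  have sp: "space \<nu> = y ` {..N}" using sets_eq_imp_space_eq[of \<nu> "count_space (y ` {..N})"] \<nu>(2) by simp
  have atom: "measure \<mu> {x \<in> space \<mu>. F x = i} = measure \<nu> {y i}" if i: "i \<le> N" for i
  proof (cases i)
    case 0
    then have "{y p | p. p \<le> 0} = {y i}" by auto
    then show ?thesis using cum[of 0] 0 by simp
  next
    case (Suc r)
    have ms: "{x \<in> space \<mu>. F x \<in> B} \<in> sets \<mu>" for B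
      using measurable_sets[OF F(1), of B] by (simp add: vimage_def Int_def conj_commute)
    have "{x \<in> space \<mu>. F x \<le> i} = {x \<in> space \<mu>. F x \<le> r} \<union> {x \<in> space \<mu>. F x = i}"
      using Suc by auto
    then have "measure \<mu> {x \<in> space \<mu>. F x \<le> i} =
        measure \<mu> {x \<in> space \<mu>. F x \<le> r} + measure \<mu> {x \<in> space \<mu>. F x = i}"
      using \<mu>.finite_measure_Union[of "{x \<in> space \<mu>. F x \<le> r}" "{x \<in> space \<mu>. F x = i}"]
        ms[of "{..r}"] ms[of "{i}"] Suc by fastforce
    moreover have "{y p | p. p \<le> i} = {y p | p. p \<le> r} \<union> {y i}" using Suc le_Suc_eq by auto
    moreover have "y i \<noteq> y p" if "p \<le> r" for p
      using inj_onD[OF inj, of i p] that i Suc by auto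
    moreover have "{y p | p. p \<le> r} \<in> sets \<nu>" "{y i} \<in> sets \<nu>" using i Suc by (auto simp: \<nu>)
    ultimately have "measure \<mu> {x \<in> space \<mu>. F x \<le> i} =
          measure \<mu> {x \<in> space \<mu>. F x \<le> r} + measure \<mu> {x \<in> space \<mu>. F x = i}"
        "measure \<nu> {y p | p. p \<le> i} = measure \<nu> {y p | p. p \<le> r} + measure \<nu> {y i}"
      using \<nu>.finite_measure_Union[of "{y p | p. p \<le> r}" "{y i}"] by auto
    then show ?thesis using cum[of i] cum[of r] i Suc by simp
  qed
  have T: "(\<lambda>x. y (F x)) \<in> measurable \<mu> \<nu>"
    using F measurable_compose[OF F(1), of "\<lambda>i. y (min i N)" \<nu>] sp by (auto simp: min_absorb1)
  show ?thesis
  proof (rule measure_eqI_finite)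
    fix a assume "a \<in> y ` {..N}"
    then obtain i where i: "i \<le> N" "a = y i" by auto
    have "(\<lambda>x. y (F x)) -` {a} \<inter> space \<mu> = {x \<in> space \<mu>. F x = i}"
      using inj F(2) i by (auto dest: inj_onD)
    then show "emeasure (distr \<mu> \<nu> (\<lambda>x. y (F x))) {a} = emeasure \<nu> {a}"
      using atom[OF i(1)] i
      by (simp add: emeasure_distr[OF T] \<nu> \<mu>.emeasure_eq_measure \<nu>.emeasure_eq_measure)
  qed (simp_all add: \<nu>)
qed

section \<open>Duality and complementary slackness\<close>

lemma coupling_integral_split:
  fixes u :: "'a \<Rightarrow> real" and v :: "'b \<Rightarrow> real"
  assumes \<gamma>: "\<gamma> \<in> couplings \<mu> \<nu>" and u: "integrable \<mu> u" and v: "integrable \<nu> v"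
  shows "integrable \<gamma> (\<lambda>p. u (fst p) + v (snd p))"
    and "(\<integral>p. u (fst p) + v (snd p) \<partial>\<gamma>) = (\<integral>x. u x \<partial>\<mu>) + (\<integral>t. v t \<partial>\<nu>)"
proof -
  have S: "sets \<gamma> = sets (\<mu> \<Otimes>\<^sub>M \<nu>)" and D: "distr \<gamma> \<mu> fst = \<mu>" "distr \<gamma> \<nu> snd = \<nu>"
    using \<gamma> by (auto simp: couplings_def)
  have m: "fst \<in> measurable \<gamma> \<mu>" "snd \<in> measurable \<gamma> \<nu>"
    using measurable_cong_sets[OF S refl] measurable_fst measurable_snd by blast+
  have iu: "integrable \<gamma> (\<lambda>p. u (fst p))" using u integrable_distr[OF m(1), of u] D by simp
  have iv: "integrable \<gamma> (\<lambda>p. v (snd p))" using v integrable_distr[OF m(2), of v] D by simp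
  have "(\<integral>p. u (fst p) \<partial>\<gamma>) = (\<integral>x. u x \<partial>\<mu>)"
    using integral_distr[OF m(1), of u] D u by simp
  moreover have "(\<integral>p. v (snd p) \<partial>\<gamma>) = (\<integral>t. v t \<partial>\<nu>)"
    using integral_distr[OF m(2), of v] D v by simp
  ultimately show "(\<integral>p. u (fst p) + v (snd p) \<partial>\<gamma>) = (\<integral>x. u x \<partial>\<mu>) + (\<integral>t. v t \<partial>\<nu>)"
    using iu iv by simp
  show "integrable \<gamma> (\<lambda>p. u (fst p) + v (snd p))" using iu iv by simp
qed

lemma weak_duality:
  assumes \<gamma>: "\<gamma> \<in> couplings \<mu> \<nu>" and uv: "dual_feasible \<mu> \<nu> b u v"
    and int: "integrable \<gamma> (\<lambda>(x, t). b x t)"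
  shows "(\<integral>(x, t). b x t \<partial>\<gamma>) \<le> (\<integral>x. u x \<partial>\<mu>) + (\<integral>t. v t \<partial>\<nu>)"
proof -
  have "sets \<gamma> = sets (\<mu> \<Otimes>\<^sub>M \<nu>)" using \<gamma> by (auto simp: couplings_def)
  then have sp: "space \<gamma> = space \<mu> \<times> space \<nu>"
    by (metis sets_eq_imp_space_eq space_pair_measure)
  have "(\<integral>(x, t). b x t \<partial>\<gamma>) \<le> (\<integral>p. u (fst p) + v (snd p) \<partial>\<gamma>)"
    using uv by (intro integral_mono int coupling_integral_split[OF \<gamma>])
      (auto simp: sp dual_feasible_def)
  then show ?thesis
    using coupling_integral_split[OF \<gamma>, of u v] uv by (simp add: dual_feasible_def)
qed

text \<open>
  If a feasible pair is tight on a coupling, both sides of weak duality have the same value there, so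
  neither the pair nor the coupling can be improved.
\<close>
lemma complementary_slackness:
  assumes \<gamma>: "\<gamma> \<in> couplings \<mu> \<nu>" and uv: "dual_feasible \<mu> \<nu> b u v"
    and int: "\<And>\<gamma>. \<gamma> \<in> couplings \<mu> \<nu> \<Longrightarrow> integrable \<gamma> (\<lambda>(x, t). b x t)"
    and tight: "AE (x, t) in \<gamma>. u x + v t = b x t"
  shows "solves_dual \<mu> \<nu> b u v" and "optimal_plan \<mu> \<nu> b \<gamma>"
proof -
  have split: "integrable \<gamma> (\<lambda>p. u (fst p) + v (snd p))"
    "(\<integral>p. u (fst p) + v (snd p) \<partial>\<gamma>) = (\<integral>x. u x \<partial>\<mu>) + (\<integral>t. v t \<partial>\<nu>)"
    using coupling_integral_split[OF \<gamma>] uv by (auto simp: dual_feasible_def)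
  have eq: "(\<integral>(x, t). b x t \<partial>\<gamma>) = (\<integral>x. u x \<partial>\<mu>) + (\<integral>t. v t \<partial>\<nu>)"
    unfolding split(2)[symmetric]
    using tight borel_measurable_integrable[OF int[OF \<gamma>]] borel_measurable_integrable[OF split(1)]
    by (intro integral_cong_AE) (auto simp: case_prod_unfold elim!: eventually_mono)
  show "solves_dual \<mu> \<nu> b u v"
    unfolding solves_dual_def using uv weak_duality[OF \<gamma> _ int[OF \<gamma>]] eq by simp
  show "optimal_plan \<mu> \<nu> b \<gamma>"
    unfolding optimal_plan_def using \<gamma> weak_duality[OF _ uv int] eq by simp
qed

lemma graph_coupling:
  assumes \<mu>: "prob_space \<mu>" and T: "T \<in> measurable \<mu> \<nu>" and push: "distr \<mu> \<nu> T = \<nu>"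
  shows "distr \<mu> (\<mu> \<Otimes>\<^sub>M \<nu>) (\<lambda>x. (x, T x)) \<in> couplings \<mu> \<nu>"
proof -
  have G: "(\<lambda>x. (x, T x)) \<in> measurable \<mu> (\<mu> \<Otimes>\<^sub>M \<nu>)" using T by simp
  show ?thesis
    using G push prob_space.prob_space_distr[OF \<mu> G]
    by (simp add: couplings_def distr_distr comp_def distr_id2)
qed

text \<open>
  Integrability of \<open>u\<close> is inherited from \<open>b\<close>: almost everywhere, \<open>u\<close> is the surplus along the graph
  of \<open>T\<close>, whose plan is a coupling, minus the integrable function \<open>v \<circ> T\<close>.
\<close>
lemma tight_map_optimal:
  assumes \<mu>: "prob_space \<mu>" and T: "T \<in> measurable \<mu> \<nu>" and push: "distr \<mu> \<nu> T = \<nu>"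
    and int: "\<And>\<gamma>. \<gamma> \<in> couplings \<mu> \<nu> \<Longrightarrow> integrable \<gamma> (\<lambda>(x, t). b x t)"
    and u: "u \<in> borel_measurable \<mu>" and v: "integrable \<nu> v"
    and feas: "\<And>x t. x \<in> space \<mu> \<Longrightarrow> t \<in> space \<nu> \<Longrightarrow> b x t \<le> u x + v t"
    and tight: "AE x in \<mu>. u x + v (T x) = b x (T x)"
  shows "solves_dual \<mu> \<nu> b u v"
    and "optimal_plan \<mu> \<nu> b (distr \<mu> (\<mu> \<Otimes>\<^sub>M \<nu>) (\<lambda>x. (x, T x)))"
proof -
  let ?\<gamma> = "distr \<mu> (\<mu> \<Otimes>\<^sub>M \<nu>) (\<lambda>x. (x, T x))"
  have G: "(\<lambda>x. (x, T x)) \<in> measurable \<mu> (\<mu> \<Otimes>\<^sub>M \<nu>)" using T by simp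
  have \<gamma>: "?\<gamma> \<in> couplings \<mu> \<nu>" by (rule graph_coupling[OF \<mu> T push])
  have bm: "(\<lambda>(x, t). b x t) \<in> borel_measurable (\<mu> \<Otimes>\<^sub>M \<nu>)"
    using borel_measurable_integrable[OF int[OF \<gamma>]] by simp
  have "integrable \<mu> (\<lambda>x. b x (T x))"
    using integrable_distr[OF G int[OF \<gamma>]] by simp
  moreover have "integrable \<mu> (\<lambda>x. v (T x))"
    using v integrable_distr[OF T, of v] push by simp
  ultimately have "integrable \<mu> (\<lambda>x. b x (T x) - v (T x))" by simp
  then have "integrable \<mu> u"
    using tight u by (subst integrable_cong_AE[where g = "\<lambda>x. b x (T x) - v (T x)"])
      (auto elim!: eventually_mono)
  then have uv: "dual_feasible \<mu> \<nu> b u v" using v feas by (simp add: dual_feasible_def)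
  have "Measurable.pred (\<mu> \<Otimes>\<^sub>M \<nu>) (\<lambda>p. u (fst p) + v (snd p) = (case p of (x, t) \<Rightarrow> b x t))"
    using bm u borel_measurable_integrable[OF v] by measurable
  then have "AE p in ?\<gamma>. u (fst p) + v (snd p) = (case p of (x, t) \<Rightarrow> b x t)"
    using tight by (subst AE_distr_iff[OF G]) (auto simp: pred_def)
  then have "AE (x, t) in ?\<gamma>. u x + v t = b x t" by (simp add: case_prod_unfold)
  then show "solves_dual \<mu> \<nu> b u v" "optimal_plan \<mu> \<nu> b ?\<gamma>"
    using complementary_slackness[OF \<gamma> uv int] by auto
qed

section \<open>Optimality of the cell potentials and the cell map\<close>

theorem theorem6:
  fixes X :: "(real ^ 'm) set"
    and y :: "nat \<Rightarrow> real"
    and N :: nat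
    and b :: "real ^ 'm \<Rightarrow> real \<Rightarrow> real"
    and \<mu> :: "(real ^ 'm) measure"
    and \<nu> :: "real measure"
    and k :: "nat \<Rightarrow> real"
  assumes domain: "open X" "connected X" "bounded X"
    and N: "N \<ge> 1"
    and y: "strict_mono_on {..N} y"
    and b_cont: "continuous_on (X \<times> y ` {..N}) (\<lambda>(x, t). b x t)"
    and b_diff: "\<And>x i. x \<in> X \<Longrightarrow> i \<le> N \<Longrightarrow> (\<lambda>x. b x (y i)) differentiable at x"
    and b_nondeg: "\<And>x i. x \<in> X \<Longrightarrow> 0 < i \<Longrightarrow> i \<le> N \<Longrightarrow>
          frechet_derivative (\<lambda>x. b x (y i)) (at x) \<noteq> frechet_derivative (\<lambda>x. b x (y (i - 1))) (at x)"
    and \<mu>: "prob_space \<mu>" "sets \<mu> = sets (restrict_space borel X)"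
    and \<mu>_pos: "\<And>A. open A \<Longrightarrow> A \<noteq> {} \<Longrightarrow> A \<subseteq> X \<Longrightarrow> measure \<mu> A > 0"
    and \<nu>: "prob_space \<nu>" "sets \<nu> = Pow (y ` {..N})"
    \<comment> \<open>the functional to be maximized is defined on all competitors\<close>
    and b_int: "\<And>\<gamma>. \<gamma> \<in> couplings \<mu> \<nu> \<Longrightarrow> integrable \<gamma> (\<lambda>(x, t). b x t)"
    and k: "splitting_levels \<mu> \<nu> b y N k"
    and nested: "discretely_nested \<mu> \<nu> b y N k"
    and level_null: "\<And>i c. i < N \<Longrightarrow> measure \<mu> (level_eq X b y i c) = 0"
    \<comment> \<open>prescribing values cell by cell is unambiguous; only needed as an assumption if an interior
      point of \<open>Y\<close> has no mass, because then nestedness does not imply it\<close>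
    and cells_disjoint: "\<And>i. 0 < i \<Longrightarrow> i < N \<Longrightarrow> measure \<nu> {y i} = 0 \<Longrightarrow>
          disjoint_family_on (cell X b y N k) {..N}"
  shows "(\<forall>a v. (\<forall>j<N. a j \<in> level_eq X b y j (k j)) \<longrightarrow>
            v (y 0) = 0 \<longrightarrow>
            (\<forall>i\<le>N. v (y i) = (\<Sum>j<i. b (a j) (y (Suc j)) - b (a j) (y j))) \<longrightarrow>
            (\<exists>u. (\<forall>i\<le>N. \<forall>x\<in>cell X b y N k i. u x = b x (y i) - v (y i)) \<and>
                 solves_dual \<mu> \<nu> b u v) \<and>
            (\<forall>u. (\<forall>i\<le>N. \<forall>x\<in>cell X b y N k i. u x = b x (y i) - v (y i)) \<longrightarrow>
                 u \<in> borel_measurable \<mu> \<longrightarrow>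
                 (\<forall>x \<in> X - (\<Union>i\<le>N. cell X b y N k i). \<forall>i\<le>N. u x + v (y i) \<ge> b x (y i)) \<longrightarrow>
                 solves_dual \<mu> \<nu> b u v))
       \<and> (\<exists>T \<in> X \<rightarrow> y ` {..N}. \<forall>i\<le>N. \<forall>x\<in>cell X b y N k i. T x = y i)
       \<and> (\<forall>T \<in> X \<rightarrow> y ` {..N}. (\<forall>i\<le>N. \<forall>x\<in>cell X b y N k i. T x = y i) \<longrightarrow>
            optimal_map \<mu> \<nu> b T)"
proof -
  interpret \<mu>: prob_space \<mu> by fact
  interpret \<nu>: prob_space \<nu> by fact
  define F where "F = first_drop b y N k"
  define T0 where "T0 x = y (F x)" for x
  have inj: "inj_on y {..N}" using y by (rule strict_mono_on_imp_inj_on)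
  have sp\<mu>: "space \<mu> = X"
    using sets_eq_imp_space_eq[OF \<mu>(2)] by (simp add: space_restrict_space)
  have sp\<nu>: "space \<nu> = y ` {..N}" using sets_eq_imp_space_eq[of \<nu> "count_space (y ` {..N})"] \<nu>(2) by simp
  have cont: "continuous_on X (\<lambda>x. b x (y i))" if "i \<le> N" for i
  proof -
    have "continuous_on X ((\<lambda>(x, t). b x t) \<circ> (\<lambda>x. (x, y i)))"
      by (intro continuous_on_compose continuous_intros continuous_on_subset[OF b_cont]) (use that in auto)
    then show ?thesis by (simp add: comp_def)
  qed
  have b_meas: "(\<lambda>x. b x (y i)) \<in> borel_measurable \<mu>" if "i \<le> N" for i
    using borel_measurable_continuous_on_restrict[OF cont[OF that]] measurable_cong_sets[OF \<mu>(2) refl]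
    by blast
  have incr_meas: "incr b y j \<in> borel_measurable \<mu>" if "j < N" for j
    using b_meas[of j] b_meas[of "Suc j"] that by simp
  have generic: "AE x in \<mu>. \<forall>j<N. incr b y j x \<noteq> k j"
  proof -
    have "AE x in \<mu>. incr b y j x \<noteq> k j" if j: "j < N" for j
    proof -
      have "{x \<in> space \<mu>. incr b y j x = k j} \<in> sets \<mu>" using incr_meas[OF j] by measurable
      moreover have "measure \<mu> {x \<in> space \<mu>. incr b y j x = k j} = 0"
        using level_null[OF j, of "k j"] by (simp add: level_eq_def sp\<mu>)
      ultimately show ?thesis
        by (subst AE_iff_measurable[OF _ refl]) (auto simp: \<mu>.emeasure_eq_measure)
    qed
    then have "AE x in \<mu>. \<forall>j\<in>{..<N}. incr b y j x \<noteq> k j" by (intro AE_finite_allI) auto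
    then show ?thesis by (auto elim!: eventually_mono)
  qed
  \<comment> \<open>A nonempty open set has positive mass, so it cannot consist of non-generic points.\<close>
  have dense: "\<exists>z\<in>A. \<forall>j<N. incr b y j z \<noteq> k j" if A: "open A" "A \<noteq> {}" "A \<subseteq> X" for A
  proof (rule ccontr)
    assume "\<not> ?thesis"
    with generic have "AE x in \<mu>. x \<notin> A" by (auto elim!: eventually_mono)
    then have "measure \<mu> A = 0"
      using A by (subst \<mu>.prob_eq_0) (auto simp: \<mu>(2) sets_restrict_space)
    then show False using \<mu>_pos[OF A] by simp
  qed
  \<comment> \<open>If every interior \<open>y i\<close> carries mass, nestedness separates the cells; otherwise
    disjointness is available through \<open>cells_disjoint\<close>.\<close>
  have disj: "disjoint_family_on (cell X b y N k) {..N}"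
    using nested_imp_cells_disjoint[OF N \<nu>.finite_measure_axioms \<nu>(2) nested] cells_disjoint sp\<mu> by blast
  have best: "b x (y l) - (\<Sum>j<l. k j) \<le> b x (y i) - (\<Sum>j<i. k j)"
    if "i \<le> N" "l \<le> N" "x \<in> cell X b y N k i" for x i l
    using that cell_signs[OF N domain(1) cont dense disj that(1,3)]
    by (intro sign_pattern_best_reply[where N = N]) auto
  have cell_unique: "l = i" if "i \<le> N" "l \<le> N" "x \<in> cell X b y N k i" "x \<in> cell X b y N k l" for x i l
    using disj that unfolding disjoint_family_on_def by (metis IntI atMost_iff empty_iff)
  have FN: "F x \<le> N" for x unfolding F_def by (rule first_drop_le)
  have F_meas: "F \<in> measurable \<mu> (count_space UNIV)"
    unfolding F_def using incr_meas by (rule measurable_first_drop)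
  have in_cell: "x \<in> cell X b y N k (F x)" if "x \<in> X" "\<forall>j<N. incr b y j x \<noteq> k j" for x
    unfolding F_def using generic_in_cell_first_drop[OF N that(1)] that(2) by blast
  have T0: "T0 \<in> measurable \<mu> \<nu>"
    unfolding T0_def
    using FN measurable_compose[OF F_meas, of "\<lambda>i. y (min i N)" \<nu>] sp\<nu> by (auto simp: min_absorb1)
  \<comment> \<open>Up to a null set, the sign pattern turns \<open>F x \<le> r\<close> into \<open>incr b y r x \<le> k r\<close>, whose mass the
    splitting levels prescribe; for \<open>r = N\<close> there is no level and both sides are total masses.\<close>
  have cum: "measure \<mu> {x \<in> space \<mu>. F x \<le> r} = measure \<nu> {y p | p. p \<le> r}" if r: "r \<le> N" for r
  proof (cases "r = N")
    case True
    then have "{y p | p. p \<le> r} = space \<nu>" "{x \<in> space \<mu>. F x \<le> r} = space \<mu>"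
      using FN by (auto simp: sp\<nu>)
    then show ?thesis by (simp add: \<mu>.prob_space \<nu>.prob_space)
  next
    case False
    then have rN: "r < N" using r by simp
    have "measure \<mu> {x \<in> space \<mu>. F x \<le> r} = measure \<mu> (level_le X b y r (k r))"
    proof (rule measure_eq_AE)
      show "AE x in \<mu>. x \<in> {x \<in> space \<mu>. F x \<le> r} \<longleftrightarrow> x \<in> level_le X b y r (k r)"
        using generic AE_space
      proof eventually_elim
        case (elim x)
        then have x: "x \<in> X" "x \<in> cell X b y N k (F x)" "\<forall>j<N. incr b y j x \<noteq> k j"
          using in_cell sp\<mu> by auto
        show ?case
          using generic_cell_signs[OF N disj FN x(2), of r] x rN by (cases "F x \<le> r")
            (auto simp: level_le_def sp\<mu>)
      qed
      show "{x \<in> space \<mu>. F x \<le> r} \<in> sets \<mu>" using F_meas by measurable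
      have "{x \<in> space \<mu>. incr b y r x \<le> k r} \<in> sets \<mu>" using incr_meas[OF rN] by measurable
      then show "level_le X b y r (k r) \<in> sets \<mu>" by (simp add: level_le_def sp\<mu>)
    qed
    then show ?thesis using k rN by (simp add: splitting_levels_def sp\<mu>)
  qed
  have push: "distr \<mu> \<nu> T0 = \<nu>"
    unfolding T0_def
    by (rule distr_eq_of_cumulative[OF \<mu>.finite_measure_axioms \<nu>.finite_measure_axioms \<nu>(2) inj F_meas FN cum])
  let ?\<gamma> = "distr \<mu> (\<mu> \<Otimes>\<^sub>M \<nu>) (\<lambda>x. (x, T0 x))"
  have core: "solves_dual \<mu> \<nu> b u v \<and> optimal_plan \<mu> \<nu> b ?\<gamma>"
    if v: "\<forall>i\<le>N. v (y i) = (\<Sum>j<i. k j)"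
      and u: "\<forall>i\<le>N. \<forall>x\<in>cell X b y N k i. u x = b x (y i) - v (y i)"
      and u_meas: "u \<in> borel_measurable \<mu>"
      and off: "\<forall>x \<in> X - (\<Union>i\<le>N. cell X b y N k i). \<forall>i\<le>N. u x + v (y i) \<ge> b x (y i)" for u v
  proof -
    have "v \<in> borel_measurable \<nu>" by (auto simp: measurable_def \<nu> sp\<nu>)
    then have v_int: "integrable \<nu> v"
      by (intro \<nu>.integrable_const_bound[where B = "Max ((\<lambda>t. norm (v t)) ` y ` {..N})"] AE_I2)
        (auto simp: sp\<nu>)
    have feas: "b x t \<le> u x + v t" if "x \<in> space \<mu>" "t \<in> space \<nu>" for x t
    proof -
      obtain l where l: "l \<le> N" "t = y l" using \<open>t \<in> space \<nu>\<close> unfolding sp\<nu> by blast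
      show ?thesis
      proof (cases "\<exists>i\<le>N. x \<in> cell X b y N k i")
        case True
        then obtain i where i: "i \<le> N" "x \<in> cell X b y N k i" by blast
        show ?thesis using best[OF i(1) l(1) i(2)] u v i l by auto
      next
        case False
        then show ?thesis using off that l sp\<mu> by auto
      qed
    qed
    have "AE x in \<mu>. u x + v (T0 x) = b x (T0 x)"
      using generic AE_space
    proof eventually_elim
      case (elim x)
      then have "x \<in> cell X b y N k (F x)" using in_cell sp\<mu> by auto
      then have "u x = b x (y (F x)) - v (y (F x))" using u FN by blast
      then show ?case by (simp add: T0_def)
    qed
    then show ?thesis
      using tight_map_optimal[OF \<mu>(1) T0 push b_int u_meas v_int feas] by blast
  qed
  \<comment> \<open>The pointwise smallest feasible \<open>u\<close>, the transform of \<open>v\<close>, meets the prescription on the cells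
    because the reply attached to the cell attains the maximum.\<close>
  have ex: "\<exists>u. (\<forall>i\<le>N. \<forall>x\<in>cell X b y N k i. u x = b x (y i) - v (y i)) \<and>
      solves_dual \<mu> \<nu> b u v \<and> optimal_plan \<mu> \<nu> b ?\<gamma>"
    if v: "\<forall>i\<le>N. v (y i) = (\<Sum>j<i. k j)" for v
  proof -
    define u where "u x = Max ((\<lambda>i. b x (y i) - v (y i)) ` {..N})" for x
    have "u x = b x (y i) - v (y i)" if "i \<le> N" "x \<in> cell X b y N k i" for i x
      unfolding u_def using best[OF that(1) _ that(2)] v that by (intro Max_eqI) auto
    moreover have "u \<in> borel_measurable \<mu>"
      unfolding u_def using b_meas by (intro borel_measurable_Max) auto
    moreover have "b x (y i) \<le> u x + v (y i)" if "i \<le> N" for x i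
    proof -
      have "b x (y i) - v (y i) \<le> u x" unfolding u_def using that by (intro Max_ge) auto
      then show ?thesis by simp
    qed
    ultimately show ?thesis using core[OF v, of u] by blast
  qed
  have v_levels: "\<forall>i\<le>N. v (y i) = (\<Sum>j<i. k j)"
    if "\<forall>j<N. a j \<in> level_eq X b y j (k j)"
      "\<forall>i\<le>N. v (y i) = (\<Sum>j<i. b (a j) (y (Suc j)) - b (a j) (y j))"
    for a and v :: "real \<Rightarrow> real"
    using that by (auto simp: level_eq_def intro!: sum.cong)
  \<comment> \<open>The points \<open>a j\<close> may fail to exist, as a level set can be empty; the plan is therefore
    certified by a potential built from the levels themselves.\<close>
  have plan: "optimal_plan \<mu> \<nu> b ?\<gamma>"
    using ex[of "\<lambda>t. \<Sum>j<inv_into {..N} y t. k j"] inj by (auto simp: inv_into_f_f)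
  have T_ex: "\<exists>T \<in> X \<rightarrow> y ` {..N}. \<forall>i\<le>N. \<forall>x\<in>cell X b y N k i. T x = y i"
  proof
    define T where "T x = y (if \<exists>i\<le>N. x \<in> cell X b y N k i then THE i. i \<le> N \<and> x \<in> cell X b y N k i else 0)" for x
    have T: "T x = y i" if "i \<le> N" "x \<in> cell X b y N k i" for x i
    proof -
      have "(THE i. i \<le> N \<and> x \<in> cell X b y N k i) = i"
        using that cell_unique by (intro the_equality) auto
      then show ?thesis unfolding T_def using that by auto
    qed
    then show "\<forall>i\<le>N. \<forall>x\<in>cell X b y N k i. T x = y i" by blast
    show "T \<in> X \<rightarrow> y ` {..N}"
    proof
      fix x show "T x \<in> y ` {..N}"
      proof (cases "\<exists>i\<le>N. x \<in> cell X b y N k i")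
        case True
        then show ?thesis using T by auto
      qed (auto simp: T_def)
    qed
  qed
  have T_opt: "optimal_map \<mu> \<nu> b T"
    if T: "T \<in> X \<rightarrow> y ` {..N}" "\<forall>i\<le>N. \<forall>x\<in>cell X b y N k i. T x = y i" for T
  proof -
    have G: "(\<lambda>x. (x, T0 x)) \<in> measurable \<mu> (\<mu> \<Otimes>\<^sub>M \<nu>)" using T0 by simp
    have id: "(\<lambda>t. t) \<in> borel_measurable \<nu>" by (auto simp: measurable_def \<nu> sp\<nu>)
    \<comment> \<open>The set where \<open>T\<close> and \<open>T0\<close> agree need not be measurable. Genericity of the first coordinate
      is a measurable condition that implies agreement, so it is pushed forward instead.\<close>
    have "(\<lambda>x. T0 x) \<in> borel_measurable \<mu>" using measurable_compose[OF T0 id] .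
    then have "Measurable.pred (\<mu> \<Otimes>\<^sub>M \<nu>) (\<lambda>p. snd p = T0 (fst p) \<and> (\<forall>j<N. incr b y j (fst p) \<noteq> k j))"
      using id incr_meas by measurable
    then have "AE p in ?\<gamma>. snd p = T0 (fst p) \<and> (\<forall>j<N. incr b y j (fst p) \<noteq> k j)"
      using generic by (subst AE_distr_iff[OF G]) (auto simp: pred_def)
    then have "AE p in ?\<gamma>. snd p = T (fst p)"
      using AE_space
    proof eventually_elim
      case (elim p)
      then have "fst p \<in> cell X b y N k (F (fst p))" using in_cell sp\<mu> by (auto simp: space_pair_measure)
      then have "T (fst p) = y (F (fst p))" using T(2) FN by blast
      then show ?case using elim by (simp add: T0_def)
    qed
    then show ?thesis unfolding optimal_map_def using plan T sp\<mu> sp\<nu> by auto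
  qed
  show ?thesis
  proof (intro conjI allI impI ballI T_ex)
    fix a v
    assume "\<forall>j<N. a j \<in> level_eq X b y j (k j)"
      and "\<forall>i\<le>N. v (y i) = (\<Sum>j<i. b (a j) (y (Suc j)) - b (a j) (y j))"
    then have v: "\<forall>i\<le>N. v (y i) = (\<Sum>j<i. k j)" by (rule v_levels)
    show "\<exists>u. (\<forall>i\<le>N. \<forall>x\<in>cell X b y N k i. u x = b x (y i) - v (y i)) \<and> solves_dual \<mu> \<nu> b u v"
      using ex[OF v] by blast
    show "solves_dual \<mu> \<nu> b u v"
      if "\<forall>i\<le>N. \<forall>x\<in>cell X b y N k i. u x = b x (y i) - v (y i)" "u \<in> borel_measurable \<mu>"
        "\<forall>x \<in> X - (\<Union>i\<le>N. cell X b y N k i). \<forall>i\<le>N. u x + v (y i) \<ge> b x (y i)" for u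
      using core[OF v that(1) that(2) that(3)] by blast
  qed (rule T_opt)
qed

end
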